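(* Let $\Sigma\subset\mathbb{R}^3$ be an immersed rotationally symmetric self-shrinking torus, and let $\Gamma$ be its cross-section. For a nonnegative integer $k$, let $L_k$ be the $k$th Fourier component of the stability operator. Let $\Delta_\Gamma^\sigma$ denote the Laplacian on $\Gamma$ with respect to (the restriction to $\Gamma$ of) the conformally changed metric $g^\sigma=\sigma^2(dr^2+dz^2)$ with $\sigma=\frac12re^{-|x|^2/4}$. Then $$L_k=\sigma\Delta_\Gamma^\sigma\sigma+1+\frac{1-k^2}{r^2},$$ that is, $L_ku=\sigma\,\Delta_\Gamma^\sigma(\sigma u)+\left(1+\frac{1-k^2}{r^2}\right)u$ for all $u\colon\Gamma\to\mathbb{R}$.
   Context: Let $x$ be the position vector in $\mathbb{R}^3$, with cylindrical coordinates $(r,\theta,z)$; the axis of rotation is $\{r=0\}$, $|x|^2=r^2+z^2$, and $e_r$ is the unit radial vector. For an immersed oriented hypersurface with unit normal $\mathbf{n}$, write $v^\perp=\langle v,\mathbf{n}\rangle$, $A(v,w)=(\nabla_vw)^\perp$ for the second fundamental form, and $H=-\operatorname{tr}A$. A surface $\Sigma$ is a self-shrinker if $\sqrt{-t}\,\Sigma$, $t<0$, evolves by mean curvature flow $\dot x=-H_\Sigma\mathbf{n}$; equivalently $H_\Sigma=\frac12x^\perp$. A rotationally symmetric torus is generated by rotating its cross-section $\Gamma$, an immersed closed curve in the open half-plane $\{(r,z):r>0\}$. Functions on $\Gamma$ are smooth functions on the parametrizing circle. In terms of $\Gamma$, the self-shrinker equation is $H_\Gamma=\frac12x^\perp-\frac1re_r^\perp$.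 The $k$th Fourier component of the stability operator is, with respect to the Euclidean metric, $$L_k=\mathcal{L}_\Gamma+|A_\Gamma|^2+\frac1{r^2}|e_r^\perp|^2+\frac12-\frac{k^2}{r^2},\qquad\mathcal{L}_\Gamma u=\sigma^{-1}\operatorname{div}_\Gamma(\sigma\operatorname{grad}_\Gamma u),$$ acting on functions $u\colon\Gamma\to\mathbb{R}$, where $A_\Gamma$ is the second fundamental form of $\Gamma$ in the Euclidean half-plane. The sign convention for Laplacians is $\Delta=\operatorname{div}\operatorname{grad}$. *)

theory Defs
  imports "HOL-Analysis.Analysis" "HOL-Library.Periodic_Fun"
begin

section \<open>Curves and functions on the circle\<close>

definition vderiv :: "(real \<Rightarrow> 'a::real_normed_vector) \<Rightarrow> real \<Rightarrow> 'a" where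
  "vderiv c t = vector_derivative c (at t)"

definition smooth :: "(real \<Rightarrow> 'a::real_normed_vector) \<Rightarrow> bool" where
  "smooth c \<longleftrightarrow> (\<forall>k t. (vderiv ^^ k) c differentiable (at t))"

text \<open>The parametrizing circle is the quotient of the real line by \<open>T\<close> times the integers;
  functions on it are represented by \<open>T\<close>-periodic functions of a real variable.\<close>

definition smooth_on_circle :: "real \<Rightarrow> (real \<Rightarrow> 'a::real_normed_vector) \<Rightarrow> bool" where
  "smooth_on_circle T c \<longleftrightarrow> periodic_fun_simple c T \<and> smooth c"

text \<open>Points of the half-plane are pairs \<open>(r, z)\<close>. Both orientations of a curve are covered, since
  reversing the parameter reverses the unit normal \<open>curve_normal\<close> below.\<close>

definition closed_half_plane_curve :: "real \<Rightarrow> (real \<Rightarrow> real \<times> real) \<Rightarrow> bool" where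
  "closed_half_plane_curve T \<gamma> \<longleftrightarrow>
     T > 0 \<and> smooth_on_circle T \<gamma> \<and> (\<forall>t. vderiv \<gamma> t \<noteq> 0) \<and> (\<forall>t. fst (\<gamma> t) > 0)"

section \<open>Parametrized surfaces in three-space\<close>

definition partial1 :: "(real \<Rightarrow> real \<Rightarrow> 'a::real_normed_vector) \<Rightarrow> real \<Rightarrow> real \<Rightarrow> 'a" where
  "partial1 F s \<theta> = vderiv (\<lambda>s'. F s' \<theta>) s"

definition partial2 :: "(real \<Rightarrow> real \<Rightarrow> 'a::real_normed_vector) \<Rightarrow> real \<Rightarrow> real \<Rightarrow> 'a" where
  "partial2 F s \<theta> = vderiv (\<lambda>\<theta>'. F s \<theta>') \<theta>"

definition surface_normal :: "(real \<Rightarrow> real \<Rightarrow> real^3) \<Rightarrow> real \<Rightarrow> real \<Rightarrow> real^3" where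
  "surface_normal F s \<theta> = sgn (cross3 (partial1 F s \<theta>) (partial2 F s \<theta>))"

text \<open>The mean curvature is minus the trace, with respect to the induced metric \<open>g\<close>, of the second
  fundamental form. The latter has the coefficients \<open>a\<^sub>i\<^sub>j\<close> (normal components of the second
  partial derivatives), and the inverse of \<open>g\<close> is written out by Cramer's rule.\<close>

definition mean_curvature :: "(real \<Rightarrow> real \<Rightarrow> real^3) \<Rightarrow> real \<Rightarrow> real \<Rightarrow> real" where
  "mean_curvature F s \<theta> =
    (let g11 = partial1 F s \<theta> \<bullet> partial1 F s \<theta>;
         g12 = partial1 F s \<theta> \<bullet> partial2 F s \<theta>;
         g22 = partial2 F s \<theta> \<bullet> partial2 F s \<theta>;
         n = surface_normal F s \<theta>;
         a11 = partial1 (partial1 F) s \<theta> \<bullet> n;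
         a12 = partial1 (partial2 F) s \<theta> \<bullet> n;
         a22 = partial2 (partial2 F) s \<theta> \<bullet> n
     in - (g22 * a11 - 2 * g12 * a12 + g11 * a22) / (g11 * g22 - g12\<^sup>2))"

definition self_shrinker :: "(real \<Rightarrow> real \<Rightarrow> real^3) \<Rightarrow> bool" where
  "self_shrinker F \<longleftrightarrow>
     (\<forall>s \<theta>. mean_curvature F s \<theta> = 1/2 * (F s \<theta> \<bullet> surface_normal F s \<theta>))"

definition surface_of_revolution :: "(real \<Rightarrow> real \<times> real) \<Rightarrow> real \<Rightarrow> real \<Rightarrow> real^3" where
  "surface_of_revolution \<gamma> s \<theta> =
     vector [fst (\<gamma> s) * cos \<theta>, fst (\<gamma> s) * sin \<theta>, snd (\<gamma> s)]"

section \<open>Gradient, divergence and Laplacian on a curve\<close>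

text \<open>A Riemannian metric on the parametrizing circle is given by its coefficient \<open>g t > 0\<close>, the
  squared length of the coordinate vector field, and a vector field by its coefficient with respect
  to the coordinate vector field. The one-dimensional cases of the usual coordinate formulas are:\<close>

definition grad_wrt :: "(real \<Rightarrow> real) \<Rightarrow> (real \<Rightarrow> real) \<Rightarrow> real \<Rightarrow> real" where
  "grad_wrt g u t = vderiv u t / g t"

definition div_wrt :: "(real \<Rightarrow> real) \<Rightarrow> (real \<Rightarrow> real) \<Rightarrow> real \<Rightarrow> real" where
  "div_wrt g X t = vderiv (\<lambda>s. sqrt (g s) * X s) t / sqrt (g t)"

definition laplacian_wrt :: "(real \<Rightarrow> real) \<Rightarrow> (real \<Rightarrow> real) \<Rightarrow> real \<Rightarrow> real" where
  "laplacian_wrt g u = div_wrt g (grad_wrt g u)"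

definition euclidean_metric :: "(real \<Rightarrow> real \<times> real) \<Rightarrow> real \<Rightarrow> real" where
  "euclidean_metric \<gamma> t = vderiv \<gamma> t \<bullet> vderiv \<gamma> t"

section \<open>The cross-section and the Fourier components of the stability operator\<close>

definition curve_normal :: "(real \<Rightarrow> real \<times> real) \<Rightarrow> real \<Rightarrow> real \<times> real" where
  "curve_normal \<gamma> t = sgn (- snd (vderiv \<gamma> t), fst (vderiv \<gamma> t))"

text \<open>Squared norm, with respect to the induced metric, of the second fundamental form of the curve
  in the Euclidean half-plane.\<close>

definition curve_A_norm_sq :: "(real \<Rightarrow> real \<times> real) \<Rightarrow> real \<Rightarrow> real" where
  "curve_A_norm_sq \<gamma> t =
     (vderiv (vderiv \<gamma>) t \<bullet> curve_normal \<gamma> t)\<^sup>2 / (euclidean_metric \<gamma> t)\<^sup>2"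

definition e_r :: "real \<times> real" where
  "e_r = (1, 0)"

definition \<sigma> :: "real \<times> real \<Rightarrow> real" where
  "\<sigma> p = 1/2 * fst p * exp (- (norm p)\<^sup>2 / 4)"

definition conformal_metric :: "(real \<Rightarrow> real \<times> real) \<Rightarrow> real \<Rightarrow> real" where
  "conformal_metric \<gamma> t = (\<sigma> (\<gamma> t))\<^sup>2 * euclidean_metric \<gamma> t"

definition weighted_laplacian ::
    "(real \<Rightarrow> real \<times> real) \<Rightarrow> (real \<Rightarrow> real) \<Rightarrow> real \<Rightarrow> real" where
  "weighted_laplacian \<gamma> u t =
     1 / \<sigma> (\<gamma> t) * div_wrt (euclidean_metric \<gamma>)
       (\<lambda>s. \<sigma> (\<gamma> s) * grad_wrt (euclidean_metric \<gamma>) u s) t"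

definition stability_component ::
    "nat \<Rightarrow> (real \<Rightarrow> real \<times> real) \<Rightarrow> (real \<Rightarrow> real) \<Rightarrow> real \<Rightarrow> real" where
  "stability_component k \<gamma> u t =
     weighted_laplacian \<gamma> u t
     + (curve_A_norm_sq \<gamma> t
        + 1 / (fst (\<gamma> t))\<^sup>2 * (e_r \<bullet> curve_normal \<gamma> t)\<^sup>2
        + 1/2 - (real k)\<^sup>2 / (fst (\<gamma> t))\<^sup>2) * u t"

end

theory Submission
  imports Defs
begin

text \<open>
  The operator \<open>\<sigma> \<Delta>\<^sup>\<sigma> \<sigma>\<close> and the weighted Laplacian have the same derivative terms and differ only
  by a potential. On a one-dimensional manifold with Laplacian \<open>\<Delta>\<close>, passing to the metric \<open>\<sigma>\<^sup>2 g\<close> and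
  conjugating with \<open>\<sigma>\<close> gives \<open>\<sigma> \<Delta>\<^sup>\<sigma> (\<sigma> u) = \<sigma>\<^sup>-\<^sup>1 div (\<sigma> grad u) + (\<Delta> ln \<sigma>) u\<close>
  (\<open>conformal_conjugation\<close>); this holds for every positive weight. The theorem therefore reduces to a
  formula for the potential \<open>\<Delta>\<^sub>\<Gamma> ln \<sigma>\<close>.

  In terms of an arclength parameter, \<open>ln \<sigma> = ln r - |x|\<^sup>2 / 4 + const\<close> has second derivative
  \<open>\<kappa> (e\<^sub>r\<^sup>\<bottom> / r - x\<^sup>\<bottom> / 2) - (1 - (e\<^sub>r\<^sup>\<bottom>)\<^sup>2) / r\<^sup>2 - 1/2\<close>, because the acceleration is \<open>\<kappa> n\<close> and the
  tangential part of \<open>e\<^sub>r\<close> has squared length \<open>1 - (e\<^sub>r\<^sup>\<bottom>)\<^sup>2\<close> (\<open>laplacian_ln_\<sigma>\<close>). The self-shrinker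
  equation says that the bracket is \<open>\<kappa>\<close> itself (\<open>self_shrinker_profile\<close>), so the first term is
  \<open>\<kappa>\<^sup>2 = |A\<^sub>\<Gamma>|\<^sup>2\<close>, and the potential \<open>|A\<^sub>\<Gamma>|\<^sup>2 + (e\<^sub>r\<^sup>\<bottom>)\<^sup>2 / r\<^sup>2 + 1/2 - k\<^sup>2 / r\<^sup>2\<close> of \<open>L\<^sub>k\<close> exceeds
  \<open>\<Delta>\<^sub>\<Gamma> ln \<sigma>\<close> by exactly \<open>1 + (1 - k\<^sup>2) / r\<^sup>2\<close>.
\<close>

lemma smooth_has_vector_derivative:
  assumes "smooth c"
  shows "(c has_vector_derivative vderiv c t) (at t)"
    and "(vderiv c has_vector_derivative vderiv (vderiv c) t) (at t)"
proof -
  have "(vderiv ^^ 0) c differentiable (at t)" "(vderiv ^^ 1) c differentiable (at t)"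
    using assms unfolding smooth_def by blast+
  then show "(c has_vector_derivative vderiv c t) (at t)"
    and "(vderiv c has_vector_derivative vderiv (vderiv c) t) (at t)"
    by (simp_all add: vderiv_def vector_derivative_works)
qed

lemma vderiv_eqI: "(c has_vector_derivative d) (at t) \<Longrightarrow> vderiv c t = d"
  unfolding vderiv_def by (rule vector_derivative_at)

lemma vderiv_real_eqI: "(c has_real_derivative d) (at t) \<Longrightarrow> vderiv c t = d"
  by (simp add: has_real_derivative_iff_has_vector_derivative vderiv_eqI)

lemma smooth_pair_components:
  fixes \<gamma> :: "real \<Rightarrow> real \<times> real"
  assumes "smooth \<gamma>"
  shows "((\<lambda>s. fst (\<gamma> s)) has_real_derivative fst (vderiv \<gamma> t)) (at t)"
    and "((\<lambda>s. snd (\<gamma> s)) has_real_derivative snd (vderiv \<gamma> t)) (at t)"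
    and "((\<lambda>s. fst (vderiv \<gamma> s)) has_real_derivative fst (vderiv (vderiv \<gamma>) t)) (at t)"
    and "((\<lambda>s. snd (vderiv \<gamma> s)) has_real_derivative snd (vderiv (vderiv \<gamma>) t)) (at t)"
  using smooth_has_vector_derivative[OF assms, of t]
  by (auto simp: has_real_derivative_iff_has_vector_derivative
      intro: bounded_linear.has_vector_derivative[OF bounded_linear_fst]
             bounded_linear.has_vector_derivative[OF bounded_linear_snd])


section \<open>Conjugating a one-dimensional Laplacian with a conformal factor\<close>

lemma laplacian_wrt_eq:
  assumes "\<And>s. g s > 0"
  shows "laplacian_wrt g u t = vderiv (\<lambda>s. vderiv u s / sqrt (g s)) t / sqrt (g t)"
proof -
  have "sqrt (g s) * (vderiv u s / g s) = vderiv u s / sqrt (g s)" for s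
    using assms[of s] by (simp add: field_simps flip: power2_eq_square)
  then show ?thesis
    unfolding laplacian_wrt_def div_wrt_def grad_wrt_def by simp
qed

text \<open>
  In dimension one the conformal factor cancels in \<open>(e\<^sup>l u)' / (e\<^sup>l \<surd>g) = u' / \<surd>g + (l' / \<surd>g) u\<close>.
  Differentiating the right-hand side once more yields the weighted Laplacian of \<open>u\<close>, and in
  addition the Laplacian of \<open>l\<close> times \<open>u\<close>.
\<close>

lemma conformal_conjugation:
  fixes g l u :: "real \<Rightarrow> real"
  assumes g: "\<And>s. g s > 0"
    and l: "\<And>s. l differentiable (at s)"
    and u: "\<And>s. u differentiable (at s)"
    and l': "(\<lambda>s. vderiv l s / sqrt (g s)) differentiable (at t)"
    and u': "(\<lambda>s. vderiv u s / sqrt (g s)) differentiable (at t)"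
  shows "exp (l t) * laplacian_wrt (\<lambda>s. (exp (l s))\<^sup>2 * g s) (\<lambda>s. exp (l s) * u s) t
    = 1 / exp (l t) * div_wrt g (\<lambda>s. exp (l s) * grad_wrt g u s) t + laplacian_wrt g l t * u t"
proof -
  let ?p = "\<lambda>s. sqrt (g s)"
  have pos: "?p s > 0" for s using g by simp
  have dl: "(l has_real_derivative vderiv l s) (at s)" for s
    using l unfolding has_real_derivative_iff_has_vector_derivative
    by (simp add: vderiv_def vector_derivative_works)
  have du: "(u has_real_derivative vderiv u s) (at s)" for s
    using u unfolding has_real_derivative_iff_has_vector_derivative
    by (simp add: vderiv_def vector_derivative_works)
  define X where "X = vderiv (\<lambda>s. vderiv l s / ?p s) t"
  define Y where "Y = vderiv (\<lambda>s. vderiv u s / ?p s) t"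
  have dX: "((\<lambda>s. vderiv l s / ?p s) has_real_derivative X) (at t)"
    using l' unfolding has_real_derivative_iff_has_vector_derivative X_def
    by (simp add: vderiv_def vector_derivative_works)
  have dY: "((\<lambda>s. vderiv u s / ?p s) has_real_derivative Y) (at t)"
    using u' unfolding has_real_derivative_iff_has_vector_derivative Y_def
    by (simp add: vderiv_def vector_derivative_works)
  have d_prod: "vderiv (\<lambda>s. exp (l s) * u s) s = exp (l s) * (vderiv l s * u s + vderiv u s)" for s
    by (rule vderiv_real_eqI) (auto intro!: derivative_eq_intros dl du simp: algebra_simps)
  have cancel: "vderiv (\<lambda>s. exp (l s) * u s) s / sqrt ((exp (l s))\<^sup>2 * g s)
      = vderiv l s / ?p s * u s + vderiv u s / ?p s" for s
    by (simp add: d_prod real_sqrt_mult add_divide_distrib)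
  have "vderiv (\<lambda>s. vderiv l s / ?p s * u s + vderiv u s / ?p s) t
      = X * u t + vderiv u t * (vderiv l t / ?p t) + Y"
    by (rule vderiv_real_eqI) (intro DERIV_add DERIV_mult dX dY du)
  then have conf: "laplacian_wrt (\<lambda>s. (exp (l s))\<^sup>2 * g s) (\<lambda>s. exp (l s) * u s) t
      = (X * u t + vderiv u t * (vderiv l t / ?p t) + Y) / (exp (l t) * ?p t)"
    using g by (subst laplacian_wrt_eq) (simp_all add: cancel, simp add: real_sqrt_mult)
  have "?p s * (exp (l s) * (vderiv u s / g s)) = exp (l s) * (vderiv u s / ?p s)" for s
    using g[of s] by (simp add: field_simps flip: power2_eq_square)
  moreover have "vderiv (\<lambda>s. exp (l s) * (vderiv u s / ?p s)) t
      = exp (l t) * vderiv l t * (vderiv u t / ?p t) + Y * exp (l t)"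
    by (rule vderiv_real_eqI) (intro DERIV_mult dY DERIV_fun_exp dl)
  ultimately have weighted: "div_wrt g (\<lambda>s. exp (l s) * grad_wrt g u s) t
      = (exp (l t) * vderiv l t * (vderiv u t / ?p t) + Y * exp (l t)) / ?p t"
    by (simp add: div_wrt_def grad_wrt_def)
  have lap: "laplacian_wrt g l t = X / ?p t"
    using g by (simp add: laplacian_wrt_eq X_def)
  define q where "q = ?p t"
  have "q > 0" using pos by (simp add: q_def)
  then show ?thesis
    unfolding conf weighted lap q_def[symmetric] by (simp add: field_simps)
qed


section \<open>The self-shrinker equation on the cross-section\<close>

definition signed_curvature :: "(real \<Rightarrow> real \<times> real) \<Rightarrow> real \<Rightarrow> real" where
  "signed_curvature \<gamma> t = (vderiv (vderiv \<gamma>) t \<bullet> curve_normal \<gamma> t) / euclidean_metric \<gamma> t"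

lemma curve_A_norm_sq_eq: "curve_A_norm_sq \<gamma> t = (signed_curvature \<gamma> t)\<^sup>2"
  by (simp add: curve_A_norm_sq_def signed_curvature_def power_divide)

lemma euclidean_metric_eq:
  "euclidean_metric \<gamma> t = (fst (vderiv \<gamma> t))\<^sup>2 + (snd (vderiv \<gamma> t))\<^sup>2"
  by (simp add: euclidean_metric_def inner_prod_def power2_eq_square)

lemma curve_normal_eq:
  "curve_normal \<gamma> t = (1 / sqrt (euclidean_metric \<gamma> t)) *\<^sub>R (- snd (vderiv \<gamma> t), fst (vderiv \<gamma> t))"
  by (simp add: curve_normal_def sgn_div_norm norm_Pair euclidean_metric_eq add.commute divide_inverse)

lemma signed_curvature_eq:
  "signed_curvature \<gamma> t
    = (fst (vderiv \<gamma> t) * snd (vderiv (vderiv \<gamma>) t) - snd (vderiv \<gamma> t) * fst (vderiv (vderiv \<gamma>) t))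
      / (sqrt (euclidean_metric \<gamma> t) * euclidean_metric \<gamma> t)"
  by (simp add: signed_curvature_def curve_normal_eq inner_prod_def diff_divide_distrib algebra_simps)

lemma speed_has_real_derivative:
  assumes smooth: "smooth \<gamma>" and regular: "vderiv \<gamma> t \<noteq> 0"
  shows "((\<lambda>s. sqrt (euclidean_metric \<gamma> s)) has_real_derivative
    (vderiv \<gamma> t \<bullet> vderiv (vderiv \<gamma>) t) / sqrt (euclidean_metric \<gamma> t)) (at t)"
proof -
  note D = smooth_pair_components[OF smooth, of t]
  have pos: "euclidean_metric \<gamma> t > 0"
    using regular by (simp add: euclidean_metric_def)
  have "(euclidean_metric \<gamma> has_real_derivative 2 * (vderiv \<gamma> t \<bullet> vderiv (vderiv \<gamma>) t)) (at t)"
    unfolding euclidean_metric_eq[abs_def] inner_prod_def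
    by (auto intro!: derivative_eq_intros D simp: algebra_simps)
  from DERIV_chain2[OF DERIV_real_sqrt[OF pos] this] show ?thesis
    by (simp add: field_simps)
qed

lemma has_vector_derivative_vector_3:
  fixes f g h :: "real \<Rightarrow> real"
  assumes "(f has_real_derivative f') (at t)" "(g has_real_derivative g') (at t)"
    "(h has_real_derivative h') (at t)"
  shows "((\<lambda>s. vector [f s, g s, h s] :: real^3) has_vector_derivative vector [f', g', h']) (at t)"
proof -
  have eq: "(vector [a, b, c] :: real^3) = a *\<^sub>R axis 1 1 + b *\<^sub>R axis 2 1 + c *\<^sub>R axis 3 1" for a b c
    by (simp add: vec_eq_iff forall_3 axis_def)
  show ?thesis
    unfolding eq using assms
    by (auto intro!: derivative_eq_intros)
qed

text \<open>
  The rotations are isometries, so it suffices to evaluate the surface equation at \<open>\<theta> = 0\<close>. There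
  the principal directions are the coordinate directions, with second fundamental form \<open>\<kappa>\<close> along
  the profile and \<open>-e\<^sub>r\<^sup>\<bottom> / r\<close> along the circle of rotation.
\<close>

lemma self_shrinker_profile:
  assumes smooth: "smooth \<gamma>" and regular: "vderiv \<gamma> t \<noteq> 0" and pos: "fst (\<gamma> t) > 0"
    and shrinker: "self_shrinker (surface_of_revolution \<gamma>)"
  shows "signed_curvature \<gamma> t
    = (e_r \<bullet> curve_normal \<gamma> t) / fst (\<gamma> t) - 1/2 * (\<gamma> t \<bullet> curve_normal \<gamma> t)"
proof -
  let ?F = "surface_of_revolution \<gamma>"
  define r z a b c d where "r = fst (\<gamma> t)" and "z = snd (\<gamma> t)"
    and "a = fst (vderiv \<gamma> t)" and "b = snd (vderiv \<gamma> t)"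
    and "c = fst (vderiv (vderiv \<gamma>) t)" and "d = snd (vderiv (vderiv \<gamma>) t)"
  note defs = this
  define p where "p = sqrt (euclidean_metric \<gamma> t)"
  note D = smooth_pair_components[OF smooth]
  have F1: "partial1 ?F =
      (\<lambda>s \<theta>. vector [fst (vderiv \<gamma> s) * cos \<theta>, fst (vderiv \<gamma> s) * sin \<theta>, snd (vderiv \<gamma> s)])"
    unfolding partial1_def surface_of_revolution_def
    by (intro ext vderiv_eqI has_vector_derivative_vector_3)
       (auto intro!: derivative_eq_intros D)
  have F2: "partial2 ?F = (\<lambda>s \<theta>. vector [- fst (\<gamma> s) * sin \<theta>, fst (\<gamma> s) * cos \<theta>, 0])"
    unfolding partial2_def surface_of_revolution_def
    by (intro ext vderiv_eqI has_vector_derivative_vector_3)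
       (auto intro!: derivative_eq_intros)
  have F11: "partial1 (partial1 ?F) t 0 = vector [c, 0, d]"
    unfolding F1 defs unfolding partial1_def
    by (intro vderiv_eqI has_vector_derivative_vector_3)
       (auto intro!: derivative_eq_intros D)
  have F12: "partial1 (partial2 ?F) t 0 = vector [0, a, 0]"
    unfolding F2 defs unfolding partial1_def
    by (intro vderiv_eqI has_vector_derivative_vector_3)
       (auto intro!: derivative_eq_intros D)
  have F22: "partial2 (partial2 ?F) t 0 = vector [- r, 0, 0]"
    unfolding F2 defs unfolding partial2_def
    by (intro vderiv_eqI has_vector_derivative_vector_3)
       (auto intro!: derivative_eq_intros)
  have F1': "partial1 ?F t 0 = vector [a, 0, b]" and F2': "partial2 ?F t 0 = vector [0, r, 0]"
    by (simp_all add: F1 F2 defs)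
  have psq: "p\<^sup>2 = a\<^sup>2 + b\<^sup>2" and p_alt: "p = sqrt (a\<^sup>2 + b\<^sup>2)"
    by (simp_all add: p_def euclidean_metric_eq defs)
  have "a \<noteq> 0 \<or> b \<noteq> 0"
    using regular by (auto simp: defs prod_eq_iff)
  then have p0: "p > 0"
    unfolding p_alt by (simp add: sum_power2_gt_zero_iff)
  have r0: "r > 0" using pos by (simp add: defs)
  have cross: "cross3 (partial1 ?F t 0) (partial2 ?F t 0) = r *\<^sub>R vector [- b, 0, a]"
    by (simp add: F1' F2' cross3_def vec_eq_iff forall_3)
  have "norm (vector [- b, 0, a] :: real^3) = p"
    by (simp add: norm_eq_sqrt_inner inner_vec_def sum_3 p_alt power2_eq_square add.commute)
  then have N: "surface_normal ?F t 0 = vector [- b / p, 0, a / p]"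
    unfolding surface_normal_def cross using r0
    by (simp add: sgn_scaleR, simp add: sgn_div_norm vec_eq_iff forall_3 divide_inverse)
  have F0: "?F t 0 = vector [r, 0, z]"
    by (simp add: surface_of_revolution_def defs)
  have "mean_curvature ?F t 0 = - (r\<^sup>2 * ((a * d - b * c) / p) + p\<^sup>2 * (r * b / p)) / (p\<^sup>2 * r\<^sup>2)"
  proof -
    have "partial1 ?F t 0 \<bullet> partial1 ?F t 0 = p\<^sup>2" "partial1 ?F t 0 \<bullet> partial2 ?F t 0 = 0"
      "partial2 ?F t 0 \<bullet> partial2 ?F t 0 = r\<^sup>2"
      unfolding F1' F2' psq by (simp_all add: inner_vec_def sum_3 power2_eq_square)
    moreover have "partial1 (partial1 ?F) t 0 \<bullet> surface_normal ?F t 0 = (a * d - b * c) / p"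
      "partial2 (partial2 ?F) t 0 \<bullet> surface_normal ?F t 0 = r * b / p"
      unfolding F11 F22 N
      by (simp_all add: inner_vec_def sum_3 diff_divide_distrib mult.commute)
    ultimately show ?thesis by (simp add: mean_curvature_def Let_def)
  qed
  also have "\<dots> = - ((a * d - b * c) / (p * p\<^sup>2)) - b / (p * r)"
    using p0 r0 by (simp add: divide_simps power2_eq_square) (simp add: algebra_simps)
  finally have "mean_curvature ?F t 0 = - ((a * d - b * c) / (p * p\<^sup>2)) - b / (p * r)" .
  moreover have "mean_curvature ?F t 0 = 1/2 * (?F t 0 \<bullet> surface_normal ?F t 0)"
    using shrinker unfolding self_shrinker_def by blast
  moreover have "?F t 0 \<bullet> surface_normal ?F t 0 = (- r * b + z * a) / p"
    unfolding F0 N by (simp add: inner_vec_def sum_3 add_divide_distrib diff_divide_distrib)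
  moreover have "signed_curvature \<gamma> t = (a * d - b * c) / (p * p\<^sup>2)"
    unfolding signed_curvature_eq p_def defs by (simp add: euclidean_metric_eq)
  moreover have "e_r \<bullet> curve_normal \<gamma> t = - b / p"
    "\<gamma> t \<bullet> curve_normal \<gamma> t = (- r * b + z * a) / p"
    by (simp_all add: curve_normal_eq e_r_def inner_prod_def p_def defs diff_divide_distrib)
  ultimately show ?thesis by (simp add: defs(1))
qed


section \<open>The logarithmic Laplacian of the weight\<close>

text \<open>
  This is the chain rule for \<open>ln r - |x|\<^sup>2 / 4\<close> along a unit-speed curve, written in an arbitrary
  regular parameter. The tangential acceleration drops out of the Laplacian, so the second derivative
  of the curve enters only through its curvature.
\<close>

lemma laplacian_ln_\<sigma>:
  assumes smooth: "smooth \<gamma>" and regular: "\<And>s. vderiv \<gamma> s \<noteq> 0" and pos: "\<And>s. fst (\<gamma> s) > 0"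
  shows "(\<lambda>s. ln (\<sigma> (\<gamma> s))) differentiable (at t)"
    and "(\<lambda>s. vderiv (\<lambda>s. ln (\<sigma> (\<gamma> s))) s / sqrt (euclidean_metric \<gamma> s)) differentiable (at t)"
    and "laplacian_wrt (euclidean_metric \<gamma>) (\<lambda>s. ln (\<sigma> (\<gamma> s))) t
      = signed_curvature \<gamma> t
          * ((e_r \<bullet> curve_normal \<gamma> t) / fst (\<gamma> t) - 1/2 * (\<gamma> t \<bullet> curve_normal \<gamma> t))
        - (1 - (e_r \<bullet> curve_normal \<gamma> t)\<^sup>2) / (fst (\<gamma> t))\<^sup>2 - 1/2"
proof -
  let ?l = "\<lambda>s. ln (\<sigma> (\<gamma> s))"
  define r z a b c d where "r s = fst (\<gamma> s)" and "z s = snd (\<gamma> s)"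
    and "a s = fst (vderiv \<gamma> s)" and "b s = snd (vderiv \<gamma> s)"
    and "c s = fst (vderiv (vderiv \<gamma>) s)" and "d s = snd (vderiv (vderiv \<gamma>) s)" for s
  note defs = this
  have D: "(r has_real_derivative a s) (at s)" "(z has_real_derivative b s) (at s)"
    "(a has_real_derivative c s) (at s)" "(b has_real_derivative d s) (at s)" for s
    using smooth_pair_components[OF smooth, of s]
    unfolding r_def[abs_def] z_def[abs_def] a_def[abs_def] b_def[abs_def] c_def d_def by simp_all
  define p where "p s = sqrt (euclidean_metric \<gamma> s)" for s
  have r0: "r s > 0" for s using pos by (simp add: defs)
  have m: "euclidean_metric \<gamma> s = (a s)\<^sup>2 + (b s)\<^sup>2" for s
    by (simp add: euclidean_metric_eq defs)
  have m0: "(a s)\<^sup>2 + (b s)\<^sup>2 > 0" for s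
    using regular[of s] by (auto simp: sum_power2_gt_zero_iff defs prod_eq_iff)
  have p0: "p s > 0" and psq: "(p s)\<^sup>2 = (a s)\<^sup>2 + (b s)\<^sup>2" for s
    using m0[of s] by (simp_all add: p_def m)
  have l_eq: "?l = (\<lambda>s. ln (r s) - ln 2 - ((r s)\<^sup>2 + (z s)\<^sup>2) / 4)"
  proof
    fix s
    have "\<sigma> (\<gamma> s) = r s / 2 * exp (- ((r s)\<^sup>2 + (z s)\<^sup>2) / 4)"
      by (simp add: \<sigma>_def norm_prod_def defs)
    then have "?l s = ln (r s / 2) + (- ((r s)\<^sup>2 + (z s)\<^sup>2) / 4)"
      using r0[of s] by (simp only: ln_mult_pos[of "r s / 2"] half_gt_zero exp_gt_zero ln_exp)
    then show "?l s = ln (r s) - ln 2 - ((r s)\<^sup>2 + (z s)\<^sup>2) / 4"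
      using r0[of s] by (simp add: ln_div diff_divide_distrib add_divide_distrib)
  qed
  have dl: "(?l has_real_derivative (a s / r s - (r s * a s + z s * b s) / 2)) (at s)" for s
    unfolding l_eq using r0[of s]
    by (auto intro!: derivative_eq_intros D simp: field_simps)
  then show "?l differentiable (at t)"
    using real_differentiable_def by blast
  have vl: "vderiv ?l = (\<lambda>s. a s / r s - (r s * a s + z s * b s) / 2)"
    by (intro ext vderiv_real_eqI dl)
  have dp: "(p has_real_derivative (a t * c t + b t * d t) / p t) (at t)"
    using speed_has_real_derivative[OF smooth regular, of t]
    by (simp add: p_def[abs_def] inner_prod_def defs)
  define X where "X =
    (((c t * r t - a t * a t) / (r t * r t)
        - (a t * a t + r t * c t + b t * b t + z t * d t) / 2) * p t
      - (a t / r t - (r t * a t + z t * b t) / 2) * ((a t * c t + b t * d t) / p t)) / (p t * p t)"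
  have dX: "((\<lambda>s. vderiv ?l s / p s) has_real_derivative X) (at t)"
    unfolding vl X_def using r0[of t] p0[of t]
    by (auto intro!: derivative_eq_intros D dp simp: algebra_simps)
  then show "(\<lambda>s. vderiv ?l s / sqrt (euclidean_metric \<gamma> s)) differentiable (at t)"
    unfolding p_def real_differentiable_def by blast
  have "laplacian_wrt (euclidean_metric \<gamma>) ?l t = X / p t"
    using m0 vderiv_real_eqI[OF dX] by (subst laplacian_wrt_eq) (simp_all add: m p_def)
  also have "\<dots> = (a t * d t - b t * c t) / (p t * (p t)\<^sup>2)
      * ((- b t / p t) / r t - 1/2 * ((- r t * b t + z t * a t) / p t))
      - (1 - (- b t / p t)\<^sup>2) / (r t)\<^sup>2 - 1/2" (is "_ = ?R")
  proof -
    define P where "P = p t"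
    define R where "R = r t"
    have nz: "P \<noteq> 0" "R \<noteq> 0" using p0[of t] r0[of t] by (simp_all add: P_def R_def)
    have sq: "P\<^sup>2 = (a t)\<^sup>2 + (b t)\<^sup>2" using psq by (simp add: P_def)
    \<comment> \<open>Clearing denominators leaves a polynomial identity modulo \<open>P\<^sup>2 = a\<^sup>2 + b\<^sup>2\<close>.\<close>
    have "X / p t * P ^ 4 * R\<^sup>2 =
      ((c t * R - (a t)\<^sup>2) - R\<^sup>2 * ((a t)\<^sup>2 + R * c t + (b t)\<^sup>2 + z t * d t) / 2) * P\<^sup>2
      - (a t * R - R\<^sup>2 * (R * a t + z t * b t) / 2) * (a t * c t + b t * d t)"
      unfolding X_def P_def[symmetric] R_def[symmetric] using nz
      by (simp add: field_simps power2_eq_square power4_eq_xxxx)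
    also have "\<dots> = (a t * d t - b t * c t) * (- b t * R - R\<^sup>2 * (- R * b t + z t * a t) / 2)
      - (a t)\<^sup>2 * P\<^sup>2 - P\<^sup>2 * P\<^sup>2 * R\<^sup>2 / 2"
      unfolding sq by (simp add: field_simps power2_eq_square)
    also have "\<dots> = (a t * d t - b t * c t) * (- b t * R - R\<^sup>2 * (- R * b t + z t * a t) / 2)
      - (P\<^sup>2 - (b t)\<^sup>2) * P\<^sup>2 - P ^ 4 * R\<^sup>2 / 2"
      unfolding sq by (simp add: power2_eq_square power4_eq_xxxx sq[unfolded power2_eq_square])
    also have "\<dots> = ?R * P ^ 4 * R\<^sup>2"
      unfolding P_def[symmetric] R_def[symmetric] using nz
      by (simp add: field_simps power2_eq_square power4_eq_xxxx)
    finally have "X / p t * (P ^ 4 * R\<^sup>2) = ?R * (P ^ 4 * R\<^sup>2)" by (simp only: mult.assoc)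
    moreover have "P ^ 4 * R\<^sup>2 \<noteq> 0" using nz by simp
    ultimately show ?thesis by (simp only: mult_cancel_right) blast
  qed
  also have "(a t * d t - b t * c t) / (p t * (p t)\<^sup>2) = signed_curvature \<gamma> t"
    unfolding signed_curvature_eq p_def defs by (simp add: euclidean_metric_eq)
  also have "- b t / p t = e_r \<bullet> curve_normal \<gamma> t"
    by (simp add: curve_normal_eq e_r_def inner_prod_def p_def defs)
  also have "(- r t * b t + z t * a t) / p t = \<gamma> t \<bullet> curve_normal \<gamma> t"
    by (simp add: curve_normal_eq inner_prod_def p_def defs diff_divide_distrib)
  finally show "laplacian_wrt (euclidean_metric \<gamma>) ?l t
      = signed_curvature \<gamma> t
          * ((e_r \<bullet> curve_normal \<gamma> t) / fst (\<gamma> t) - 1/2 * (\<gamma> t \<bullet> curve_normal \<gamma> t))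
        - (1 - (e_r \<bullet> curve_normal \<gamma> t)\<^sup>2) / (fst (\<gamma> t))\<^sup>2 - 1/2"
    by (simp add: r_def)
qed

lemma differentiable_vderiv_over_speed:
  assumes "smooth \<gamma>" "vderiv \<gamma> t \<noteq> 0" and u: "smooth (u :: real \<Rightarrow> real)"
  shows "(\<lambda>s. vderiv u s / sqrt (euclidean_metric \<gamma> s)) differentiable (at t)"
proof -
  have "vderiv u differentiable (at t)"
    using smooth_has_vector_derivative(2)[OF u]
    by (auto simp: real_differentiable_def has_real_derivative_iff_has_vector_derivative)
  moreover have "(\<lambda>s. sqrt (euclidean_metric \<gamma> s)) differentiable (at t)"
    using speed_has_real_derivative[OF assms(1,2)] real_differentiable_def by blast
  moreover have "sqrt (euclidean_metric \<gamma> t) \<noteq> 0"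
    using assms(2) by (simp add: euclidean_metric_def)
  ultimately show ?thesis by (intro differentiable_divide)
qed


section \<open>The stability operator in the conformal metric\<close>

theorem theorem3p7:
  fixes \<gamma> :: "real \<Rightarrow> real \<times> real" and T :: real and k :: nat
  assumes "closed_half_plane_curve T \<gamma>"
    and "self_shrinker (surface_of_revolution \<gamma>)"
  shows "\<forall>u :: real \<Rightarrow> real. smooth_on_circle T u \<longrightarrow>
    (\<forall>t. stability_component k \<gamma> u t =
      \<sigma> (\<gamma> t) * laplacian_wrt (conformal_metric \<gamma>) (\<lambda>s. \<sigma> (\<gamma> s) * u s) t
      + (1 + (1 - (real k)\<^sup>2) / (fst (\<gamma> t))\<^sup>2) * u t)"
proof (intro allI impI)
  fix u :: "real \<Rightarrow> real" and t
  assume "smooth_on_circle T u"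
  then have u: "smooth u" by (simp add: smooth_on_circle_def)
  have smooth: "smooth \<gamma>" and regular: "\<And>s. vderiv \<gamma> s \<noteq> 0" and pos: "\<And>s. fst (\<gamma> s) > 0"
    using assms(1) by (auto simp: closed_half_plane_curve_def smooth_on_circle_def)
  let ?l = "\<lambda>s. ln (\<sigma> (\<gamma> s))"
  have exp_l: "exp (?l s) = \<sigma> (\<gamma> s)" for s
    using pos[of s] by (simp add: \<sigma>_def)
  have metric_pos: "euclidean_metric \<gamma> s > 0" for s
    using regular[of s] by (simp add: euclidean_metric_def)
  have "u differentiable (at s)" for s
    using smooth_has_vector_derivative(1)[OF u]
    by (auto simp: real_differentiable_def has_real_derivative_iff_has_vector_derivative)
  then have conjugation: "\<sigma> (\<gamma> t) * laplacian_wrt (conformal_metric \<gamma>) (\<lambda>s. \<sigma> (\<gamma> s) * u s) t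
      = weighted_laplacian \<gamma> u t + laplacian_wrt (euclidean_metric \<gamma>) ?l t * u t"
    using conformal_conjugation[of "euclidean_metric \<gamma>" ?l u t, unfolded exp_l]
      metric_pos laplacian_ln_\<sigma>(1,2)[OF smooth regular pos]
      differentiable_vderiv_over_speed[OF smooth regular u]
    unfolding weighted_laplacian_def conformal_metric_def[abs_def] by blast
  define n where "n = e_r \<bullet> curve_normal \<gamma> t"
  have potential: "laplacian_wrt (euclidean_metric \<gamma>) ?l t
      = (signed_curvature \<gamma> t)\<^sup>2 - (1 - n\<^sup>2) / (fst (\<gamma> t))\<^sup>2 - 1/2"
    using laplacian_ln_\<sigma>(3)[OF smooth regular pos, of t]
      self_shrinker_profile[OF smooth regular pos assms(2), of t]
    by (simp add: n_def power2_eq_square)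
  show "stability_component k \<gamma> u t =
      \<sigma> (\<gamma> t) * laplacian_wrt (conformal_metric \<gamma>) (\<lambda>s. \<sigma> (\<gamma> s) * u s) t
      + (1 + (1 - (real k)\<^sup>2) / (fst (\<gamma> t))\<^sup>2) * u t"
    unfolding conjugation potential stability_component_def curve_A_norm_sq_eq n_def[symmetric]
    by (simp add: algebra_simps diff_divide_distrib)
qed

end
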